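(* Let $t\in\mathbb{R}$ and let $G_t$ be the $t$-logistic distribution, i.e. $G_t(z)=\exp_t(z-\gamma_t(z))$ for $z\in\mathbb{R}$, where $\gamma_t(z)$ is the real number uniquely determined by $$\exp_t(z-\gamma_t(z))+\exp_t(-\gamma_t(z))=1 .$$ Put $q=\max(t,0)$. Then there exist sequences $c_m\in\mathbb{R}$ and $d_m>0$ such that, for each $z\in\mathbb{R}$, $$G_t(c_m+d_mz)=\frac1m\exp_q(z)+o(m^{-1})\quad\text{as } m\to\infty .$$
   Context: For real $q$, the $q$-exponential function is $\exp_q(z)=e^z$ if $q=1$ and $\exp_q(z)=[1+(1-q)z]_+^{1/(1-q)}$ if $q\neq 1$, where $[z]_+=\max(z,0)$; when $q>1$, a negative power of $0$ is interpreted as $\infty$, so $\exp_q(z)=\infty$ for $z\ge -1/(1-q)$. $\exp_t$ denotes the $q$-exponential function with $q=t$. The asymptotic relation $G_t(c_m+d_mz)=\frac1m\exp_q(z)+o(m^{-1})$ means $mG_t(c_m+d_mz)\to\exp_q(z)$ in $[0,\infty]$ (so $mG_t(c_m+d_mz)\to\infty$ when $\exp_q(z)=\infty$). *)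

theory Defs
  imports "HOL-Analysis.Analysis"
begin

text \<open>
  The values are taken in \<open>[0,\<infinity>]\<close>. The base is truncated at 0; for \<open>q < 1\<close> the library
  convention \<open>0 powr a = 0\<close> gives the intended positive power of 0, while for \<open>q > 1\<close> the
  negative power of 0 has to be set to \<open>\<infinity>\<close> explicitly.
\<close>

definition exp_q :: "real \<Rightarrow> real \<Rightarrow> ennreal" where
  "exp_q q z =
    (if q = 1 then ennreal (exp z)
     else if q > 1 \<and> max (1 + (1 - q) * z) 0 = 0 then \<infinity>
     else ennreal (max (1 + (1 - q) * z) 0 powr (1 / (1 - q))))"

definition logistic_gamma :: "real \<Rightarrow> real \<Rightarrow> real" where
  "logistic_gamma t z = (THE g. exp_q t (z - g) + exp_q t (- g) = 1)"

definition logistic :: "real \<Rightarrow> real \<Rightarrow> ennreal" where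
  "logistic t z = exp_q t (z - logistic_gamma t z)"

lemma exp_q_mono:
  assumes "x \<le> y"
  shows "exp_q q x \<le> exp_q q y"
proof -
  consider "q = 1" | "q < 1" | "q > 1" by linarith
  then show ?thesis
  proof cases
    case 1
    then show ?thesis using assms by (simp add: exp_q_def ennreal_leI)
  next
    case 2
    then have "(1 - q) * x \<le> (1 - q) * y" using assms by (intro mult_left_mono) auto
    then have "max (1 + (1 - q) * x) 0 powr (1 / (1 - q)) \<le> max (1 + (1 - q) * y) 0 powr (1 / (1 - q))"
      using 2 by (intro powr_mono2 max.mono add_left_mono) simp_all
    then show ?thesis using 2 by (simp add: exp_q_def ennreal_leI)
  next
    case 3
    have le: "(1 - q) * y \<le> (1 - q) * x" using assms 3 by (intro mult_left_mono_neg) auto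
    show ?thesis
    proof (cases "1 + (1 - q) * y \<le> 0")
      case True
      then show ?thesis using 3 by (simp add: exp_q_def max_def)
    next
      case False
      then have pos: "\<not> 1 + (1 - q) * x \<le> 0" using le by linarith
      from False have "(1 + (1 - q) * x) powr (1 / (1 - q)) \<le> (1 + (1 - q) * y) powr (1 / (1 - q))"
        using le 3 by (intro powr_mono2') auto
      then show ?thesis using 3 pos False by (simp add: exp_q_def max_def ennreal_leI)
    qed
  qed
qed

lemma exp_q_strict_mono:
  assumes "x < y" "0 < exp_q q x" "exp_q q x < \<infinity>"
  shows "exp_q q x < exp_q q y"
proof -
  consider "q = 1" | "q < 1" | "q > 1" by linarith
  then show ?thesis
  proof cases
    case 1
    then show ?thesis using assms by (simp add: exp_q_def ennreal_lessI)
  next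
    case 2
    have pos: "0 < 1 + (1 - q) * x"
      using assms(2) 2 by (auto simp: exp_q_def max_def split: if_splits)
    have lt: "(1 - q) * x < (1 - q) * y" using assms 2 by (intro mult_strict_left_mono) auto
    have pos': "0 < 1 + (1 - q) * y" using pos lt by linarith
    from lt have "(1 + (1 - q) * x) powr (1 / (1 - q)) < (1 + (1 - q) * y) powr (1 / (1 - q))"
      using 2 pos by (intro powr_less_mono2) auto
    then show ?thesis using 2 pos pos' by (simp add: exp_q_def max_def ennreal_lessI)
  next
    case 3
    have lt: "(1 - q) * y < (1 - q) * x" using assms 3 by (intro mult_strict_left_mono_neg) auto
    show ?thesis
    proof (cases "1 + (1 - q) * y \<le> 0")
      case True
      then show ?thesis using 3 assms(3) by (simp add: exp_q_def max_def)
    next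
      case False
      then have pos: "\<not> 1 + (1 - q) * x \<le> 0" using lt by linarith
      from False have "(1 + (1 - q) * x) powr (1 / (1 - q)) < (1 + (1 - q) * y) powr (1 / (1 - q))"
        using lt 3 by (intro powr_less_mono2_neg) auto
      then show ?thesis using 3 pos False by (simp add: exp_q_def max_def ennreal_lessI)
    qed
  qed
qed

lemma exp_q_zero [simp]: "exp_q q 0 = 1"
  by (simp add: exp_q_def)

lemma exp_q_nonpos_real:
  assumes "x \<le> 0"
  shows "exp_q q x = ennreal (if q = 1 then exp x else max (1 + (1 - q) * x) 0 powr (1 / (1 - q)))"
proof -
  have "0 < 1 + (1 - q) * x" if "q > 1"
    using that assms mult_nonpos_nonpos[of "1 - q" x] by simp
  then show ?thesis by (auto simp: exp_q_def)
qed

lemma exp_q_eq_half: "\<exists>x\<le>0. exp_q q x = ennreal (1 / 2)"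
proof (cases "q = 1")
  case True
  then show ?thesis by (intro exI[of _ "ln (1 / 2)"]) (simp add: exp_q_def)
next
  case False
  define x :: real where "x = ((1 / 2) powr (1 - q) - 1) / (1 - q)"
  have base: "1 + (1 - q) * x = (1 / 2) powr (1 - q)"
    using False by (simp add: x_def)
  have "x \<le> 0"
  proof (cases "q < 1")
    case True
    have "(1 / 2) powr (1 - q) \<le> (1 / 2 :: real) powr 0"
      using True by (intro powr_mono') auto
    then show ?thesis using True by (simp add: x_def divide_nonpos_pos)
  next
    case False
    have "(1 / 2 :: real) powr 0 \<le> (1 / 2) powr (1 - q)"
      using False by (intro powr_mono') auto
    then show ?thesis using False by (simp add: x_def divide_nonneg_nonpos)
  qed
  moreover have "exp_q q x = ennreal (1 / 2)"
    using False \<open>x \<le> 0\<close> base by (simp add: exp_q_nonpos_real powr_powr max_def)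
  ultimately show ?thesis by blast
qed

lemma logistic_gamma_unique_existence:
  "\<exists>!g. exp_q t (z - g) + exp_q t (- g) = 1"
proof (rule ex_ex1I)
  define E where "E x = (if t = 1 then exp x else max (1 + (1 - t) * x) 0 powr (1 / (1 - t)))"
    for x :: real
  have E: "exp_q t x = ennreal (E x)" if "x \<le> 0" for x
    using exp_q_nonpos_real[OF that] by (simp add: E_def)
  have E_nonneg: "0 \<le> E x" for x by (simp add: E_def)
  have E_mono: "E x \<le> E y" if "x \<le> y" "y \<le> 0" for x y
    using exp_q_mono[OF that(1), of t] that E E_nonneg by (simp add: ennreal_le_iff)
  have E0: "E 0 = 1" by (simp add: E_def)
  have pos: "0 < 1 + (1 - t) * x" if "x \<le> 0" "t > 1" for x
    using that mult_nonpos_nonpos[of "1 - t" x] by simp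
  have E_cont: "continuous_on {..0} E"
  proof (cases "t = 1")
    case True
    then show ?thesis by (simp add: E_def continuous_intros)
  next
    case False
    have "continuous_on {..0} (\<lambda>x. max (1 + (1 - t) * x) 0 powr (1 / (1 - t)))"
      using False pos
      by (intro continuous_on_powr' continuous_intros) (force simp: max_def)+
    then show ?thesis using False by (simp add: E_def)
  qed
  obtain h where h: "h \<le> 0" "E h = 1 / 2"
    using exp_q_eq_half[of t] E E_nonneg by (metis ennreal_inj half_gt_zero less_imp_le zero_less_one)
  define a where "a = max z 0"
  define F where "F g = E (z - g) + E (- g)" for g
  have "F a \<ge> 1"
    using E0 E_nonneg[of "z - a"] E_nonneg[of "- a"] by (auto simp: F_def a_def max_def)
  moreover have "F (a - h) \<le> 1"
    using E_mono[of "z - (a - h)" h] E_mono[of "- (a - h)" h] h by (simp add: F_def a_def)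
  moreover have "continuous_on {a..a - h} F"
    unfolding F_def
    by (intro continuous_on_add continuous_on_compose2[OF E_cont] continuous_intros)
      (auto simp: a_def)
  ultimately obtain g where g: "a \<le> g" "F g = 1"
    using IVT2'[of F "a - h" 1 a] h by auto
  have "z - g \<le> 0" "- g \<le> 0" using g by (auto simp: a_def)
  then have "exp_q t (z - g) + exp_q t (- g) = ennreal (F g)"
    by (simp add: E F_def E_nonneg ennreal_plus)
  then show "\<exists>g. exp_q t (z - g) + exp_q t (- g) = 1"
    using g by auto
next
  have False if eq: "exp_q t (z - g) + exp_q t (- g) = 1" "exp_q t (z - g') + exp_q t (- g') = 1"
    and "g < g'" for g g'
  proof -
    let ?A = "exp_q t (z - g)" and ?B = "exp_q t (- g)"
    let ?A' = "exp_q t (z - g')" and ?B' = "exp_q t (- g')"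
    have le: "?A' \<le> ?A" "?B' \<le> ?B"
      using \<open>g < g'\<close> by (auto intro: exp_q_mono)
    have "?A' \<le> ?A' + ?B'" "?B' \<le> ?A' + ?B'" by simp_all
    then have "?A' \<le> 1" "?B' \<le> 1" using eq by simp_all
    then have fin: "?A' < \<infinity>" "?B' < \<infinity>" 
      using le_less_trans[OF _ ennreal_one_less_top] by simp_all
    have "?A' \<noteq> 0 \<or> ?B' \<noteq> 0" using eq by auto
    then have "?A' + ?B' < ?A + ?B"
    proof
      assume "?A' \<noteq> 0"
      then have "?A' < ?A"
        using \<open>g < g'\<close> fin by (intro exp_q_strict_mono) (auto simp: zero_less_iff_neq_zero)
      then show ?thesis using le fin
        by (metis add.commute add_left_mono ennreal_add_left_cancel_less infinity_ennreal_def
            less_le_trans less_top)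
    next
      assume "?B' \<noteq> 0"
      then have "?B' < ?B"
        using \<open>g < g'\<close> fin by (intro exp_q_strict_mono) (auto simp: zero_less_iff_neq_zero)
      then show ?thesis using le fin
        by (metis add_right_mono ennreal_add_left_cancel_less infinity_ennreal_def
            less_le_trans less_top)
    qed
    then show False using eq by simp
  qed
  then show "g = g'" if "exp_q t (z - g) + exp_q t (- g) = 1"
    "exp_q t (z - g') + exp_q t (- g') = 1" for g g'
    using that by (meson linorder_neqE_linordered_idom)
qed

end

theory Submission
  imports Defs "HOL-Real_Asymp.Real_Asymp"
begin

text \<open>
  The convergence is proved for quantile functions. Write \<open>log_q t\<close> for the inverse of
  \<open>exp_q t\<close>. Setting \<open>p = exp_q t (z - \<gamma>)\<close> and \<open>1 - p = exp_q t (- \<gamma>)\<close> in the equation that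
  determines \<open>\<gamma>\<close> and eliminating \<open>\<gamma>\<close> shows that the logistic distribution has the quantile
  function \<open>log_q t p - log_q t (1 - p)\<close> (\<open>logistic_quantile\<close>).

  Near \<open>p = 0\<close> the two summands compete. The first is self-similar: its increment between
  \<open>1/x\<close> and \<open>s/x\<close> is exactly \<open>x powr (t - 1) * log_q t s\<close>. The second is differentiable there
  with slope 1, so its increment is about \<open>(s - 1) / x\<close>. Measured in the unit
  \<open>x powr (t - 1) + 1 / x\<close>, the increment of the quantile function is therefore a weighted
  average of \<open>log_q t s\<close> and of approximately \<open>s - 1 = log_q 0 s\<close>, with weights proportional to
  \<open>x powr t\<close> and \<open>1\<close>. As \<open>x\<close> grows, the first wins for \<open>t > 0\<close> and the second for \<open>t < 0\<close>, while
  both are equal for \<open>t = 0\<close>; the limit is \<open>log_q (max t 0) s\<close> in every case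
  (\<open>quantile_increment_tendsto\<close>).

  With \<open>c m\<close> the quantile of \<open>1/m\<close> and \<open>d m\<close> that unit for \<open>x = m\<close>, the points \<open>c m + d m * z\<close>
  eventually lie above the quantile of \<open>s/m\<close> when \<open>log_q q s < z\<close>, and below it when
  \<open>z < log_q q s\<close>. Monotonicity turns this into \<open>s \<le> m * logistic t (c m + d m * z)\<close> and the
  opposite inequality. Only comparisons with finite positive \<open>s\<close> occur, so the values \<open>0\<close> and \<open>\<infinity>\<close>
  of \<open>exp_q q z\<close> are covered by the same argument.
\<close>

section \<open>The deformed logarithm\<close>

definition log_q :: "real \<Rightarrow> real \<Rightarrow> real" where
  "log_q q s = (if q = 1 then ln s else (s powr (1 - q) - 1) / (1 - q))"

lemma exp_q_log_q:
  assumes "0 < s"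
  shows "exp_q q (log_q q s) = ennreal s"
proof (cases "q = 1")
  case True
  then show ?thesis using assms by (simp add: exp_q_def log_q_def)
next
  case False
  then have "1 + (1 - q) * log_q q s = s powr (1 - q)"
    by (simp add: log_q_def)
  then show ?thesis
    using False assms by (simp add: exp_q_def max_def powr_powr)
qed

lemma log_q_less_if_less_exp_q:
  assumes "0 < s" "ennreal s < exp_q q z"
  shows "log_q q s < z"
  using assms exp_q_mono[of z "log_q q s" q] by (simp add: exp_q_log_q) (meson leD not_le)

lemma less_log_q_if_exp_q_less:
  assumes "0 < s" "exp_q q z < ennreal s"
  shows "z < log_q q s"
  using assms exp_q_mono[of "log_q q s" z q] by (simp add: exp_q_log_q) (meson leD not_le)

lemma log_q_self_similar:
  assumes "0 < x" "0 < s"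
  shows "log_q t (s / x) - log_q t (1 / x) = x powr (t - 1) * log_q t s"
proof (cases "t = 1")
  case True
  then show ?thesis using assms by (simp add: log_q_def ln_div)
next
  case False
  have "x powr (t - 1) = 1 / x powr (1 - t)"
    by (simp add: powr_minus_divide[symmetric])
  then show ?thesis
    using False assms by (simp add: log_q_def powr_divide diff_divide_distrib mult.commute)
qed

text \<open>
  The upper end of the distribution enters only through this limit: \<open>log_q t\<close> has derivative 1
  at 1 whatever \<open>t\<close> is, and \<open>s - 1\<close> is \<open>log_q 0 s\<close>.
\<close>

lemma log_q_increment_at_one:
  fixes s t :: real
  shows "((\<lambda>x. x * (log_q t (1 - 1 / x) - log_q t (1 - s / x))) \<longlongrightarrow> s - 1) at_top"
proof -
  have slope: "((\<lambda>x. x * log_q t (1 - a / x)) \<longlongrightarrow> - a) at_top" for a :: real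
  proof (cases "t = 1")
    case True
    show ?thesis unfolding log_q_def using True by simp real_asymp
  next
    case False
    then have "1 - t \<noteq> 0" by simp
    have "((\<lambda>x. x * ((1 - a / x) powr (1 - t) - 1)) \<longlongrightarrow> - a * (1 - t)) at_top"
      by real_asymp
    from tendsto_divide[OF this tendsto_const \<open>1 - t \<noteq> 0\<close>] show ?thesis
      using False by (simp add: log_q_def)
  qed
  show ?thesis
    using tendsto_diff[OF slope[of 1] slope[of s]] by (simp add: algebra_simps)
qed

section \<open>The quantile function of the logistic distribution\<close>

definition logistic_quantile :: "real \<Rightarrow> real \<Rightarrow> real" where
  "logistic_quantile t p = log_q t p - log_q t (1 - p)"

lemma logistic_gamma_eq:
  "exp_q t (z - logistic_gamma t z) + exp_q t (- logistic_gamma t z) = 1"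
  unfolding logistic_gamma_def by (rule theI'[OF logistic_gamma_unique_existence])

lemma logistic_quantile_inverse:
  assumes "0 < p" "p < 1"
  shows "logistic t (logistic_quantile t p) = ennreal p"
proof -
  let ?z = "logistic_quantile t p" and ?g = "- log_q t (1 - p)"
  have "exp_q t (?z - ?g) + exp_q t (- ?g) = ennreal p + ennreal (1 - p)"
    using assms by (simp add: logistic_quantile_def exp_q_log_q)
  also have "\<dots> = 1"
    using assms by (simp flip: ennreal_plus)
  finally have "logistic_gamma t ?z = ?g"
    unfolding logistic_gamma_def by (rule the1_equality[OF logistic_gamma_unique_existence])
  then show ?thesis
    using assms by (simp add: logistic_def logistic_quantile_def exp_q_log_q)
qed

text \<open>
  If \<open>logistic t\<close> dropped from \<open>x\<close> to \<open>y\<close>, then \<open>\<gamma>\<close> would have to increase by more than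
  \<open>y - x\<close>; both summands of the normalisation would then be no larger at \<open>y\<close>, and the first
  one strictly smaller, although their sum is 1 at both points.
\<close>

lemma logistic_mono:
  assumes "x \<le> y"
  shows "logistic t x \<le> logistic t y"
proof (rule ccontr)
  let ?g = "logistic_gamma t x" and ?h = "logistic_gamma t y"
  assume "\<not> ?thesis"
  then have less: "exp_q t (y - ?h) < exp_q t (x - ?g)"
    by (simp add: logistic_def)
  then have "\<not> x - ?g \<le> y - ?h"
    using exp_q_mono leD by blast
  then have le: "exp_q t (- ?h) \<le> exp_q t (- ?g)"
    using assms by (intro exp_q_mono) linarith
  have "exp_q t (- ?h) \<le> 1"
    using logistic_gamma_eq[of t y] by (metis add.commute le_iff_add)
  then have "exp_q t (- ?h) < \<infinity>"
    using le_less_trans[OF _ ennreal_one_less_top] by simp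
  then have "exp_q t (y - ?h) + exp_q t (- ?h) < exp_q t (x - ?g) + exp_q t (- ?h)"
    using less by (metis add.commute ennreal_add_left_cancel_less infinity_ennreal_def less_top)
  also have "\<dots> \<le> exp_q t (x - ?g) + exp_q t (- ?g)"
    using le by (rule add_left_mono)
  finally show False
    by (simp add: logistic_gamma_eq)
qed

section \<open>The lower tail of the quantile function\<close>

lemma quantile_increment_tendsto:
  fixes s t :: real
  assumes "0 < s"
  shows "((\<lambda>x. (logistic_quantile t (s / x) - logistic_quantile t (1 / x)) /
             (x powr (t - 1) + 1 / x)) \<longlongrightarrow> log_q (max t 0) s) at_top"
proof -
  define r where "r x = x * (log_q t (1 - 1 / x) - log_q t (1 - s / x))" for x
  have r: "(r \<longlongrightarrow> s - 1) at_top"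
    unfolding r_def by (rule log_q_increment_at_one)
  have log_0: "log_q 0 s = s - 1"
    using assms by (simp add: log_q_def)
  \<comment> \<open>The scaled increment is a weighted average of \<open>log_q t s\<close> and \<open>r x\<close>.\<close>
  have average: "((\<lambda>x. v x * log_q t s + w x * r x) \<longlongrightarrow> a * log_q t s + b * (s - 1)) at_top"
    if "(v \<longlongrightarrow> a) at_top" "(w \<longlongrightarrow> b) at_top" for v w a b
    using that by (intro tendsto_intros r)
  have "((\<lambda>x. x powr t / (x powr t + 1) * log_q t s + 1 / (x powr t + 1) * r x)
          \<longlongrightarrow> log_q (max t 0) s) at_top"
  proof -
    consider "t > 0" | "t = 0" | "t < 0" by linarith
    then show ?thesis
    proof cases
      case 1
      then have "((\<lambda>x. x powr t / (x powr t + 1)) \<longlongrightarrow> 1) at_top"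
        "((\<lambda>x. 1 / (x powr t + 1)) \<longlongrightarrow> 0) at_top"
        by real_asymp+
      from average[OF this] show ?thesis
        using 1 by (simp add: max_def)
    next
      case 2
      then have "((\<lambda>x. x powr t / (x powr t + 1)) \<longlongrightarrow> 1 / 2) at_top"
        "((\<lambda>x. 1 / (x powr t + 1)) \<longlongrightarrow> 1 / 2) at_top"
        by (simp_all only:) real_asymp+
      from average[OF this] show ?thesis
        using 2 by (simp add: log_0)
    next
      case 3
      then have "((\<lambda>x. x powr t / (x powr t + 1)) \<longlongrightarrow> 0) at_top"
        "((\<lambda>x. 1 / (x powr t + 1)) \<longlongrightarrow> 1) at_top"
        by real_asymp+
      from average[OF this] show ?thesis
        using 3 by (simp add: max_def log_0)
    qed
  qed
  moreover have "\<forall>\<^sub>F x in at_top.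
      x powr t / (x powr t + 1) * log_q t s + 1 / (x powr t + 1) * r x =
      (logistic_quantile t (s / x) - logistic_quantile t (1 / x)) / (x powr (t - 1) + 1 / x)"
    using eventually_gt_at_top[of 0]
  proof eventually_elim
    case (elim x)
    have "logistic_quantile t (s / x) - logistic_quantile t (1 / x)
        = x powr (t - 1) * log_q t s + r x / x"
      using log_q_self_similar[OF elim assms, of t] elim
      by (simp add: logistic_quantile_def r_def)
    also have "\<dots> = (x powr t * log_q t s + r x) / x"
      using elim by (simp add: powr_diff add_divide_distrib)
    finally have increment: "logistic_quantile t (s / x) - logistic_quantile t (1 / x)
        = (x powr t * log_q t s + r x) / x" .
    have unit: "x powr (t - 1) + 1 / x = (x powr t + 1) / x"
      using elim by (simp add: powr_diff add_divide_distrib)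
    show ?case
      unfolding increment unit using elim
      by (simp flip: add_divide_distrib)
  qed
  ultimately show ?thesis
    by (rule Lim_transform_eventually)
qed

section \<open>From quantiles to distribution functions\<close>

text \<open>
  This is the usual passage from convergence of rescaled quantile functions to that of rescaled
  distribution functions. The limit is squeezed between real levels \<open>s\<close>, so it may be \<open>0\<close> or \<open>\<infinity>\<close>.
\<close>

lemma logistic_tendsto_if_quantile_tendsto:
  fixes c d :: "nat \<Rightarrow> real"
  assumes pos: "\<And>m. 0 < d m"
    and lim: "\<And>s. 0 < s \<Longrightarrow>
      (\<lambda>m. (logistic_quantile t (s / m) - c m) / d m) \<longlonglongrightarrow> log_q q s"
  shows "(\<lambda>m. of_nat m * logistic t (c m + d m * z)) \<longlonglongrightarrow> exp_q q z"
proof -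
  have at_quantile: "\<forall>\<^sub>F m in sequentially.
      of_nat m * logistic t (logistic_quantile t (s / m)) = ennreal s" if "0 < s" for s :: real
  proof -
    have "\<forall>\<^sub>F m in sequentially. s < real m"
      by real_asymp
    then show ?thesis
    proof eventually_elim
      case (elim m)
      then show ?case using that
        by (simp add: logistic_quantile_inverse ennreal_of_nat_eq_real_of_nat flip: ennreal_mult)
    qed
  qed
  show ?thesis
  proof (rule order_tendstoI)
    fix a assume "a < exp_q q z"
    then obtain b where b: "a < b" "b < exp_q q z"
      using dense by blast
    have "0 < b" "b < top"
      using le_less_trans[OF zero_le b(1)] less_le_trans[OF b(2) top_greatest] .
    then obtain s where s: "b = ennreal s" "0 < s"
      by (cases b) auto
    have "\<forall>\<^sub>F m in sequentially. (logistic_quantile t (s / m) - c m) / d m < z"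
      using b s by (intro order_tendstoD(2)[OF lim] log_q_less_if_less_exp_q) auto
    with at_quantile[OF s(2)]
    show "\<forall>\<^sub>F m in sequentially. a < of_nat m * logistic t (c m + d m * z)"
    proof eventually_elim
      case (elim m)
      then have "logistic_quantile t (s / m) \<le> c m + d m * z"
        using pos[of m] by (simp add: divide_less_eq algebra_simps)
      then have "b \<le> of_nat m * logistic t (c m + d m * z)"
        unfolding s(1) elim(1)[symmetric] by (intro mult_left_mono logistic_mono) auto
      then show ?case using b(1) by order
    qed
  next
    fix a assume "exp_q q z < a"
    then obtain b where b: "exp_q q z < b" "b < a"
      using dense by blast
    have "0 < b" "b < top"
      using le_less_trans[OF zero_le b(1)] less_le_trans[OF b(2) top_greatest] .
    then obtain s where s: "b = ennreal s" "0 < s"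
      by (cases b) auto
    have "\<forall>\<^sub>F m in sequentially. z < (logistic_quantile t (s / m) - c m) / d m"
      using b s by (intro order_tendstoD(1)[OF lim] less_log_q_if_exp_q_less) auto
    with at_quantile[OF s(2)]
    show "\<forall>\<^sub>F m in sequentially. of_nat m * logistic t (c m + d m * z) < a"
    proof eventually_elim
      case (elim m)
      then have "c m + d m * z \<le> logistic_quantile t (s / m)"
        using pos[of m] by (simp add: less_divide_eq algebra_simps)
      then have "of_nat m * logistic t (c m + d m * z) \<le> b"
        unfolding s(1) elim(1)[symmetric] by (intro mult_left_mono logistic_mono) auto
      then show ?case using b(2) by order
    qed
  qed
qed

theorem theorem2:
  fixes t q :: real
  assumes "q = max t 0"
  shows "\<exists>c d :: nat \<Rightarrow> real. (\<forall>m. d m > 0) \<and>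
    (\<forall>z. (\<lambda>m. of_nat m * logistic t (c m + d m * z)) \<longlonglongrightarrow> exp_q q z)"
proof -
  define c where "c m = logistic_quantile t (1 / real m)" for m :: nat
  \<comment> \<open>At \<open>m = 0\<close> the general formula would give \<open>0\<close>.\<close>
  define d where "d m = (if m = 0 then 1 else real m powr (t - 1) + 1 / real m)" for m :: nat
  have pos: "d m > 0" for m
    by (simp add: d_def add_pos_pos)
  have "(\<lambda>m. (logistic_quantile t (s / m) - c m) / d m) \<longlonglongrightarrow> log_q q s" if "0 < s" for s
  proof (rule Lim_transform_eventually)
    show "(\<lambda>m. (logistic_quantile t (s / real m) - logistic_quantile t (1 / real m)) /
        (real m powr (t - 1) + 1 / real m)) \<longlonglongrightarrow> log_q q s"
      using filterlim_compose[OF quantile_increment_tendsto[OF that] filterlim_real_sequentially]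
      unfolding assms .
    show "\<forall>\<^sub>F m in sequentially.
        (logistic_quantile t (s / real m) - logistic_quantile t (1 / real m)) /
        (real m powr (t - 1) + 1 / real m) = (logistic_quantile t (s / m) - c m) / d m"
      using eventually_gt_at_top[of 0] by eventually_elim (simp add: c_def d_def)
  qed
  then show ?thesis
    using pos logistic_tendsto_if_quantile_tendsto by blast
qed

end
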